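(* For each fixed $x>0$, the expression $mV_m(x)$ is increasing in $m$ for real $m>-1$.
   Context: For real $m>-1$ and $x>0$, $V_m(x)=\frac{2e^{x^2}}{\Gamma(m+1)}\int_x^\infty (t^2-x^2)^m e^{-t^2}\,dt=\frac{1}{\Gamma(m+1)}\int_0^\infty \frac{u^m e^{-u}}{\sqrt{x^2+u}}\,du$. *)

theory Defs
  imports "HOL-Analysis.Analysis"
begin

definition V :: "real \<Rightarrow> real \<Rightarrow> real" where
  "V m x = 2 * exp (x\<^sup>2) / Gamma (m + 1) *
     (LBINT t:{x<..}. (t\<^sup>2 - x\<^sup>2) powr m * exp (- t\<^sup>2))"

end

theory Submission
  imports Defs
begin

text \<open>
  The substitution \<open>u = t\<^sup>2 - x\<^sup>2\<close> turns \<open>V m x\<close> into the mean of \<open>w u = 1 / sqrt (x\<^sup>2 + u)\<close>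
  under the Gamma distribution of shape \<open>m + 1\<close>, with density \<open>p m\<close>.  For \<open>-1 < m < n\<close> the
  claim is therefore that the integral of \<open>D * w\<close> is positive, where \<open>D = n * p n - m * p m\<close>.

  If \<open>m \<le> 0 \<le> n\<close>, then \<open>D\<close> itself is positive.  Otherwise \<open>D\<close> equals \<open>p m u\<close> times a constant
  of the sign of \<open>n\<close> times \<open>u powr (n - m) - c powr (n - m)\<close>, so that it changes sign exactly
  once, at a point \<open>c\<close>.  The integral of \<open>D * w\<close> is then compared with that of \<open>D * k\<close>, where
  \<open>k\<close> agrees with \<open>w\<close> at \<open>c\<close>, lies on the side of \<open>w\<close> that makes \<open>D * (w - k)\<close> positive
  elsewhere, and makes the integral of \<open>D * k\<close> explicit:

  \<^item> for \<open>n < 0\<close> take \<open>k\<close> constant; \<open>w\<close> decreases, \<open>D\<close> passes from positive to negative, and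
    the integral of \<open>D\<close> is \<open>n - m > 0\<close> because each \<open>p\<close> has mass \<open>1\<close>;

  \<^item> for \<open>m > 0\<close> take \<open>k\<close> proportional to \<open>1 / u\<close>; now \<open>u * w u\<close> increases, \<open>D\<close> passes from
    negative to positive, and \<open>D u / u = p (n - 1) u - p (m - 1) u\<close> has integral \<open>0\<close>.

  The identity \<open>m * p m u / u = p (m - 1) u\<close>, which is the functional equation of the Gamma
  function, is what makes the factor \<open>m\<close> in front of \<open>V m x\<close> the right one.
\<close>

section \<open>Gamma densities\<close>

text \<open>The shape parameter is shifted to \<open>m + 1\<close>, so that \<open>m\<close> is the exponent occurring in \<open>V m x\<close>.\<close>

definition gamma_density :: "real \<Rightarrow> real \<Rightarrow> real" where
  "gamma_density m u = u powr m * exp (- u) / Gamma (m + 1)"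

lemma gamma_density_integral:
  assumes "m > -1"
  shows "set_integrable lborel {0<..} (gamma_density m)" "(LBINT u:{0<..}. gamma_density m u) = 1"
proof -
  have G: "Gamma (m + 1) > 0" using assms by (intro Gamma_real_pos) simp
  have "((\<lambda>t. t powr (m + 1 - 1) / exp t) has_integral Gamma (m + 1)) {0..}"
    using assms by (intro Gamma_integral_real) simp
  hence "((\<lambda>t. t powr (m + 1 - 1) / exp t / Gamma (m + 1)) has_integral Gamma (m + 1) / Gamma (m + 1)) {0..}"
    by (rule has_integral_divide)
  moreover have "(\<lambda>t. t powr (m + 1 - 1) / exp t / Gamma (m + 1)) = gamma_density m"
    by (auto simp: gamma_density_def exp_minus field_simps)
  ultimately have "(gamma_density m has_integral 1) {0..}" using G by simp
  hence I: "(gamma_density m has_integral 1) {0<..}"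
    by (rule has_integral_spike_set_eq[THEN iffD1, rotated 2])
      (auto intro!: negligible_subset[OF negligible_sing[of 0]])
  have "gamma_density m absolutely_integrable_on {0<..}"
    using I G by (intro nonnegative_absolutely_integrable_1) (auto simp: gamma_density_def)
  moreover have "(\<lambda>u. indicator {0<..} u *\<^sub>R gamma_density m u) \<in> borel_measurable lborel"
    by (simp add: gamma_density_def)
  ultimately show J: "set_integrable lborel {0<..} (gamma_density m)"
    by (simp add: set_integrable_def integrable_completion)
  show "(LBINT u:{0<..}. gamma_density m u) = 1"
    using set_borel_integral_eq_integral(2)[OF J] I by (simp add: integral_unique)
qed

lemma gamma_density_pred: "m > 0 \<Longrightarrow> u > 0 \<Longrightarrow> m * gamma_density m u / u = gamma_density (m - 1) u"
proof -
  assume m: "m > 0" and u: "u > 0"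
  have G: "Gamma (m + 1) = m * Gamma m" "Gamma m > 0"
    using m Gamma_plus1[of m] nonpos_Ints_nonpos[of m]
    by (force simp: Gamma_real_pos add.commute)+
  show ?thesis using m u G by (simp add: gamma_density_def powr_diff field_simps)
qed

section \<open>The function V as a mean under a Gamma density\<close>

lemma gamma_density_sqrt_integrable:
  assumes "m > -1" "x > 0"
  shows "set_integrable lborel {0<..} (\<lambda>u. gamma_density m u / sqrt (x\<^sup>2 + u))"
proof (rule set_integrable_bound)
  show "set_integrable lborel {0<..} (\<lambda>u. gamma_density m u / x)"
    using gamma_density_integral(1)[OF assms(1)] by simp
  show "set_borel_measurable lborel {0<..} (\<lambda>u. gamma_density m u / sqrt (x\<^sup>2 + u))"
    by (simp add: set_borel_measurable_def gamma_density_def)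
  have "x \<le> sqrt (x\<^sup>2 + u)" if "u > 0" for u
    using that assms by (intro real_le_rsqrt) simp
  thus "AE u in lborel. u \<in> {0<..} \<longrightarrow> norm (gamma_density m u / sqrt (x\<^sup>2 + u)) \<le> norm (gamma_density m u / x)"
    using assms by (auto intro!: AE_I2 divide_left_mono mult_pos_pos add_pos_pos simp: abs_mult)
qed

lemma LBINT_square_substitution:
  fixes f :: "real \<Rightarrow> real"
  assumes "set_integrable lborel {0<..} f" "x > 0" and [measurable]: "f \<in> borel_measurable borel"
  shows "(LBINT t:{x<..}. 2 * t * f (t\<^sup>2 - x\<^sup>2)) = (LBINT u:{0<..}. f u)"
proof -
  have inj: "inj_on (\<lambda>t. t\<^sup>2 - x\<^sup>2) {x<..}"
    using assms(2) by (auto simp: inj_on_def power2_eq_iff)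
  have im: "(\<lambda>t. t\<^sup>2 - x\<^sup>2) ` {x<..} = {0<..}"
  proof (intro equalityI subsetI)
    fix u assume "u \<in> (\<lambda>t. t\<^sup>2 - x\<^sup>2) ` {x<..}"
    thus "u \<in> {0<..}" using assms(2) by (auto intro!: power_strict_mono)
  next
    fix u :: real assume u: "u \<in> {0<..}"
    have "x < sqrt (x\<^sup>2 + u)" using u by (intro real_less_rsqrt) simp
    moreover have "u = (sqrt (x\<^sup>2 + u))\<^sup>2 - x\<^sup>2" using u by simp
    ultimately show "u \<in> (\<lambda>t. t\<^sup>2 - x\<^sup>2) ` {x<..}" by (intro image_eqI) auto
  qed
  have ai: "f absolutely_integrable_on {0<..}"
    using assms(1) by (simp add: set_integrable_def integrable_completion)
  have deriv: "((\<lambda>t. t\<^sup>2 - x\<^sup>2) has_field_derivative 2 * t) (at t within {x<..})" for t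
    by (auto intro!: derivative_eq_intros)
  have "(\<lambda>t. \<bar>2 * t\<bar> *\<^sub>R f (t\<^sup>2 - x\<^sup>2)) absolutely_integrable_on {x<..} \<and>
        integral {x<..} (\<lambda>t. \<bar>2 * t\<bar> *\<^sub>R f (t\<^sup>2 - x\<^sup>2)) = integral {0<..} f"
    using has_absolute_integral_change_of_variables_1'[OF _ deriv inj,
        where f = f and b = "integral {0<..} f"] ai
    by (simp add: im)
  moreover have "integral {x<..} (\<lambda>t. \<bar>2 * t\<bar> *\<^sub>R f (t\<^sup>2 - x\<^sup>2)) =
      integral {x<..} (\<lambda>t. 2 * t * f (t\<^sup>2 - x\<^sup>2))"
    using assms(2) by (intro integral_cong) auto
  moreover have "(\<lambda>t. \<bar>2 * t\<bar> *\<^sub>R f (t\<^sup>2 - x\<^sup>2)) absolutely_integrable_on {x<..} \<longleftrightarrow>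
      (\<lambda>t. 2 * t * f (t\<^sup>2 - x\<^sup>2)) absolutely_integrable_on {x<..}"
    using assms(2) by (intro set_integrable_cong) auto
  ultimately have 1: "(\<lambda>t. 2 * t * f (t\<^sup>2 - x\<^sup>2)) absolutely_integrable_on {x<..}"
     and 2: "integral {x<..} (\<lambda>t. 2 * t * f (t\<^sup>2 - x\<^sup>2)) = integral {0<..} f"
    by auto
  have "set_integrable lborel {x<..} (\<lambda>t. 2 * t * f (t\<^sup>2 - x\<^sup>2))"
    using 1 by (simp add: set_integrable_def integrable_completion)
  from set_borel_integral_eq_integral(2)[OF this] 2 set_borel_integral_eq_integral(2)[OF assms(1)]
  show ?thesis by simp
qed

lemma V_eq_gamma_mean:
  assumes "m > -1" "x > 0"
  shows "V m x = (LBINT u:{0<..}. gamma_density m u / sqrt (x\<^sup>2 + u))"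
proof -
  have "(LBINT u:{0<..}. gamma_density m u / sqrt (x\<^sup>2 + u)) =
        (LBINT t:{x<..}. 2 * t * (gamma_density m (t\<^sup>2 - x\<^sup>2) / sqrt (x\<^sup>2 + (t\<^sup>2 - x\<^sup>2))))"
    using assms by (intro LBINT_square_substitution[symmetric] gamma_density_sqrt_integrable)
      (auto simp: gamma_density_def)
  also have "\<dots> = (LBINT t:{x<..}. (2 * exp (x\<^sup>2) / Gamma (m + 1)) * ((t\<^sup>2 - x\<^sup>2) powr m * exp (- t\<^sup>2)))"
    using assms(2) by (intro set_lebesgue_integral_cong) (auto simp: gamma_density_def exp_diff exp_minus field_simps)
  also have "\<dots> = V m x"
    by (simp add: V_def)
  finally show ?thesis by simp
qed

section \<open>Positivity of integrals by comparison\<close>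

text \<open>
  The exceptional point \<open>c\<close> accommodates an integrand that touches zero at a crossing point.
\<close>

lemma set_integral_pos:
  fixes f :: "real \<Rightarrow> real"
  assumes f: "set_integrable lborel {0<..} f" and pos: "\<And>u. u > 0 \<Longrightarrow> u \<noteq> c \<Longrightarrow> f u > 0"
  shows "(LBINT u:{0<..}. f u) > 0"
proof -
  let ?g = "\<lambda>u. indicator {0<..} u * f u"
  have int: "integrable lborel ?g" using f by (simp add: set_integrable_def)
  have nn: "AE u in lborel. 0 \<le> ?g u"
    using AE_lborel_singleton[of c]
    by eventually_elim (auto simp: indicator_def intro: less_imp_le[OF pos])
  have "integral\<^sup>L lborel ?g \<noteq> 0"
  proof
    assume "integral\<^sup>L lborel ?g = 0"
    hence "AE u in lborel. ?g u = 0"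
      using integral_nonneg_eq_0_iff_AE[OF int nn] by simp
    hence "AE u in lborel. u \<notin> {0<..<1::real}"
      using AE_lborel_singleton[of c]
      by eventually_elim (use pos in \<open>force simp: indicator_def split: if_splits\<close>)
    hence "emeasure lborel {0<..<1::real} = 0"
      by (subst (asm) AE_iff_measurable[of "{0<..<1::real}"]) auto
    thus False by simp
  qed
  moreover have "integral\<^sup>L lborel ?g \<ge> 0" by (rule integral_nonneg_AE[OF nn])
  ultimately show ?thesis by (simp add: set_lebesgue_integral_def)
qed

lemma integral_pos_by_comparison:
  fixes D w k :: "real \<Rightarrow> real"
  assumes w: "set_integrable lborel {0<..} (\<lambda>u. D u * w u)"
    and k: "set_integrable lborel {0<..} (\<lambda>u. D u * k u)"
    and less: "\<And>u. u > 0 \<Longrightarrow> u \<noteq> c \<Longrightarrow> D u * (w u - k u) > 0"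
    and k0: "(LBINT u:{0<..}. D u * k u) \<ge> 0"
  shows "(LBINT u:{0<..}. D u * w u) > 0"
proof -
  have "(LBINT u:{0<..}. D u * w u - D u * k u) > 0"
    using less by (intro set_integral_pos[where c = c] set_integral_diff w k)
      (auto simp: right_diff_distrib)
  thus ?thesis using k0 set_integral_diff(2)[OF w k] by simp
qed

section \<open>The weighted difference of two Gamma densities\<close>

text \<open>
  The quotient of two Gamma densities is a constant times a power of \<open>u\<close>, so the two terms
  balance at a single point when \<open>m\<close> and \<open>n\<close> have the same sign.
\<close>

lemma gamma_density_crossing:
  assumes "-1 < m" "m < n" "0 < m * n"
  obtains A c where "sgn A = sgn n" "c > 0"
    "\<And>u. u > 0 \<Longrightarrow> n * gamma_density n u - m * gamma_density m u =
      gamma_density m u * A * (u powr (n - m) - c powr (n - m))"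
proof -
  have G: "Gamma (m + 1) > 0" "Gamma (n + 1) > 0"
    using assms by (auto intro!: Gamma_real_pos)
  define A where "A = n * Gamma (m + 1) / Gamma (n + 1)"
  define c where "c = (m / A) powr (1 / (n - m))"
  have "m / A = (m * n) * Gamma (n + 1) / (n\<^sup>2 * Gamma (m + 1))"
    by (simp add: A_def power2_eq_square)
  moreover have "n \<noteq> 0" using assms by auto
  ultimately have mA: "m / A > 0" using assms G by simp
  have c: "c powr (n - m) = m / A"
  proof -
    have "c powr (n - m) = (m / A) powr 1"
      unfolding c_def powr_powr using assms(2) by simp
    also have "\<dots> = m / A" using mA by (simp only: powr_one less_imp_le)
    finally show ?thesis .
  qed
  have A0: "A \<noteq> 0" using mA by auto
  show ?thesis
  proof
    show "sgn A = sgn n" using G by (simp add: A_def sgn_mult sgn_divide)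
    show "c > 0" using mA by (auto simp: c_def)
    fix u :: real assume u: "u > 0"
    have "u powr n = u powr m * u powr (n - m)" by (simp add: powr_add[symmetric])
    hence "n * gamma_density n u = gamma_density m u * A * u powr (n - m)"
      using G by (simp add: gamma_density_def A_def)
    moreover have "gamma_density m u * A * (m / A) = m * gamma_density m u" using A0 by simp
    ultimately show "n * gamma_density n u - m * gamma_density m u =
        gamma_density m u * A * (u powr (n - m) - c powr (n - m))"
      by (simp add: c right_diff_distrib)
  qed
qed

lemma gamma_density_pos: "m > -1 \<Longrightarrow> u > 0 \<Longrightarrow> gamma_density m u > 0"
  by (auto simp: gamma_density_def intro!: divide_pos_pos mult_pos_pos Gamma_real_pos)

text \<open>
  After cross-multiplying and squaring, the claim is \<open>u\<^sup>2 * x\<^sup>2 + u\<^sup>2 * v < v\<^sup>2 * x\<^sup>2 + v\<^sup>2 * u\<close>,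
  which holds term by term.
\<close>

lemma div_sqrt_strict_mono:
  assumes "0 < u" "u < v" "x > 0"
  shows "u / sqrt (x\<^sup>2 + u) < v / sqrt (x\<^sup>2 + v :: real)"
proof -
  have "u\<^sup>2 * x\<^sup>2 < v\<^sup>2 * x\<^sup>2" using assms by (intro mult_strict_right_mono power_strict_mono) auto
  moreover have "u * (u * v) < v * (u * v)" using assms by (intro mult_strict_right_mono) auto
  ultimately have "u\<^sup>2 * (x\<^sup>2 + v) < v\<^sup>2 * (x\<^sup>2 + u)"
    by (simp add: algebra_simps power2_eq_square)
  hence "sqrt (u\<^sup>2 * (x\<^sup>2 + v)) < sqrt (v\<^sup>2 * (x\<^sup>2 + u))" by (rule real_sqrt_less_mono)
  hence "u * sqrt (x\<^sup>2 + v) < v * sqrt (x\<^sup>2 + u)" using assms by (simp add: real_sqrt_mult)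
  moreover have "sqrt (x\<^sup>2 + v) > 0" "sqrt (x\<^sup>2 + u) > 0"
    using assms by (auto intro!: add_pos_pos)
  ultimately show ?thesis by (simp add: divide_simps)
qed

text \<open>
  The comparison function has to match the direction in which \<open>D\<close> changes sign: a constant uses
  that \<open>w\<close> decreases, a multiple of \<open>1 / u\<close> that \<open>u * w u\<close> increases.
\<close>

lemma weighted_difference_integral_pos:
  fixes x m n :: real
  assumes "x > 0" "-1 < m" "m < n"
  shows "(LBINT u:{0<..}. (n * gamma_density n u - m * gamma_density m u) * (1 / sqrt (x\<^sup>2 + u))) > 0"
proof -
  define D where "D = (\<lambda>u. n * gamma_density n u - m * gamma_density m u)"
  define w where "w = (\<lambda>u. 1 / sqrt (x\<^sup>2 + u))"
  have n: "-1 < n" using assms by simp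
  have Dw: "set_integrable lborel {0<..} (\<lambda>u. D u * w u)"
  proof -
    have "set_integrable lborel {0<..} (\<lambda>u. n * (gamma_density n u / sqrt (x\<^sup>2 + u)) -
        m * (gamma_density m u / sqrt (x\<^sup>2 + u)))"
      using assms n by (intro set_integral_diff set_integrable_mult_right gamma_density_sqrt_integrable) auto
    thus ?thesis by (simp add: D_def w_def diff_divide_distrib)
  qed
  have D: "set_integrable lborel {0<..} D" "(LBINT u:{0<..}. D u) = n - m"
    using assms n by (simp_all add: D_def set_integral_diff gamma_density_integral)
  have w_mono: "w v < w u" if "0 < u" "u < v" for u v
    using that assms by (auto simp: w_def intro!: divide_strict_left_mono mult_pos_pos add_pos_pos)
  have w_pos: "w u > 0" if "u > 0" for u
    using that by (auto simp: w_def intro!: add_nonneg_pos)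
  have "(LBINT u:{0<..}. D u * w u) > 0"
  proof (cases "m * n > 0")
    case False
    hence "m \<le> 0" "0 \<le> n" using assms by (auto simp: zero_less_mult_iff not_less)
    hence "D u > 0" if "u > 0" for u
      using that assms gamma_density_pos[of m u] gamma_density_pos[of n u] n
      by (cases "m = 0") (auto simp: D_def intro!: less_le_trans[OF mult_neg_pos, of m "gamma_density m u"])
    thus ?thesis using Dw w_pos by (intro set_integral_pos) auto
  next
    case True
    then obtain A c where Ac: "sgn A = sgn n" "c > 0"
      and D_eq: "\<And>u. u > 0 \<Longrightarrow> D u = gamma_density m u * A * (u powr (n - m) - c powr (n - m))"
      using gamma_density_crossing[OF assms(2,3)] unfolding D_def by metis
    have pw: "u powr (n - m) < v powr (n - m)" if "0 < u" "u < v" for u v :: real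
      using that assms by (intro powr_less_mono2) auto
    show ?thesis
    proof (cases "n > 0")
      case n: False
      hence "A < 0" using Ac(1) True by (auto simp: sgn_if split: if_splits)
      show ?thesis
      proof (rule integral_pos_by_comparison[OF Dw, where k = "\<lambda>_. w c" and c = c])
        show "set_integrable lborel {0<..} (\<lambda>u. D u * w c)" using D(1) by simp
        show "0 \<le> (LBINT u:{0<..}. D u * w c)"
          using D(2) assms w_pos[OF Ac(2)] by simp
        fix u :: real assume u: "u > 0" "u \<noteq> c"
        have "A * gamma_density m u < 0" using \<open>A < 0\<close> gamma_density_pos[of m u] u assms by (simp add: mult_neg_pos)
        moreover have "(u powr (n - m) - c powr (n - m)) * (w u - w c) < 0"
          using pw[of u c] pw[of c u] w_mono[of u c] w_mono[of c u] u Ac(2)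
          by (cases "u < c") (auto simp: mult_less_0_iff)
        ultimately have "(A * gamma_density m u) * ((u powr (n - m) - c powr (n - m)) * (w u - w c)) > 0"
          by (rule mult_neg_neg)
        thus "D u * (w u - w c) > 0" using D_eq[OF u(1)] by (simp add: mult_ac)
      qed
    next
      case n: True
      hence m: "m > 0" and "A > 0" using Ac(1) True by (auto simp: sgn_if zero_less_mult_iff split: if_splits)
      have Dk: "D u * (c * w c / u) = c * w c * (gamma_density (n - 1) u - gamma_density (m - 1) u)" if "u > 0" for u
        using gamma_density_pred[OF n that, symmetric] gamma_density_pred[OF m that, symmetric]
        by (simp add: D_def right_diff_distrib left_diff_distrib diff_divide_distrib mult_ac)
      show ?thesis
      proof (rule integral_pos_by_comparison[OF Dw, where k = "\<lambda>u. c * w c / u" and c = c])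
        have "set_integrable lborel {0<..} (\<lambda>u. c * w c * (gamma_density (n - 1) u - gamma_density (m - 1) u))"
          using m n by (intro set_integrable_mult_right set_integral_diff gamma_density_integral) auto
        thus "set_integrable lborel {0<..} (\<lambda>u. D u * (c * w c / u))"
          by (subst set_integrable_cong[OF refl refl Dk]) auto
        have "(LBINT u:{0<..}. D u * (c * w c / u)) =
            (LBINT u:{0<..}. c * w c * (gamma_density (n - 1) u - gamma_density (m - 1) u))"
          by (intro set_lebesgue_integral_cong) (auto simp: Dk simp del: times_divide_eq_right)
        also have "\<dots> = 0" using m n by (simp add: set_integral_diff gamma_density_integral)
        finally show "0 \<le> (LBINT u:{0<..}. D u * (c * w c / u))" by simp
        fix u :: real assume u: "u > 0" "u \<noteq> c"
        have "gamma_density m u * A / u > 0" using \<open>A > 0\<close> gamma_density_pos[of m u] u assms by simp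
        moreover have "(u powr (n - m) - c powr (n - m)) * (u * w u - c * w c) > 0"
          using pw[of u c] pw[of c u] div_sqrt_strict_mono[of u c x] div_sqrt_strict_mono[of c u x] u Ac(2) assms
          by (cases "u < c") (auto simp: zero_less_mult_iff w_def)
        ultimately have "(gamma_density m u * A / u) * ((u powr (n - m) - c powr (n - m)) * (u * w u - c * w c)) > 0"
          by (rule mult_pos_pos)
        moreover have "w u - c * w c / u = (u * w u - c * w c) / u"
          using u(1) by (simp add: field_simps)
        ultimately show "D u * (w u - c * w c / u) > 0" using D_eq[OF u(1)] by (simp add: mult_ac)
      qed
    qed
  qed
  thus ?thesis by (simp add: D_def w_def)
qed

theorem mainTheorem7:
  fixes x :: real
  assumes "x > 0"
  shows "strict_mono_on {-1<..} (\<lambda>m::real. m * V m x)"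
proof (rule strict_mono_onI)
  fix m n :: real assume mn: "m \<in> {-1<..}" "n \<in> {-1<..}" "m < n"
  let ?I = "\<lambda>m. LBINT u:{0<..}. m * (gamma_density m u / sqrt (x\<^sup>2 + u))"
  have "0 < (LBINT u:{0<..}. (n * gamma_density n u - m * gamma_density m u) * (1 / sqrt (x\<^sup>2 + u)))"
    using assms mn by (intro weighted_difference_integral_pos) auto
  also have "\<dots> = (LBINT u:{0<..}. n * (gamma_density n u / sqrt (x\<^sup>2 + u)) -
      m * (gamma_density m u / sqrt (x\<^sup>2 + u)))"
    by (simp add: diff_divide_distrib)
  also have "\<dots> = ?I n - ?I m"
    using assms mn by (intro set_integral_diff(2) set_integrable_mult_right gamma_density_sqrt_integrable) auto
  also have "\<dots> = n * V n x - m * V m x"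
    using assms mn by (simp only: V_eq_gamma_mean set_integral_mult_right greaterThan_iff)
  finally show "m * V m x < n * V n x" by simp
qed

end
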